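(* Let $N, K, M_N, M_K$ be the block dimensions and let $$A = \begin{bmatrix} A_{11} & A_{12} \\ A_{21} & A_{22} \end{bmatrix} \in \mathbb{C}^{(M_N+M_K)\times(N+K)},$$ with $A_{11}\in\mathbb{C}^{M_N\times N}$, $A_{12}\in\mathbb{C}^{M_N\times K}$, $A_{21}\in\mathbb{C}^{M_K\times N}$, $A_{22}\in\mathbb{C}^{M_K\times K}$. Let $Z_{11}^*\in\mathbb{C}^{N\times M_N}$ and set $$Z^* = \begin{bmatrix} Z_{11}^* & 0 \\ 0 & 0 \end{bmatrix} \in \mathbb{C}^{(N+K)\times(M_N+M_K)}.$$ Consider the AZ algorithm applied to $A\mathbf{x}\approx\mathbf{b}$ with this $Z^*$; the system matrix of its first step is $A - AZ^*A$. Then: 1. If $Z_{11}^*$ is the inverse of $A_{11}$, then $$A - AZ^*A = \begin{bmatrix} 0 & 0 \\ 0 & A_{22} - A_{21}Z_{11}^*A_{12} \end{bmatrix},$$ where the non-zero block is of size $M_K\times K$. 2. If $Z_{11}^*$ is a left inverse of $A_{11}$ (i.e. $Z_{11}^*A_{11} = I$), then $$A - AZ^*A = \begin{bmatrix} 0 & A_{12} - A_{11}Z_{11}^*A_{12} \\ 0 & A_{22} - A_{21}Z_{11}^*A_{12} \end{bmatrix},$$ where the non-zero block is of size $(M_N+M_K)\times K$. 3. If $Z_{11}^*$ is a right inverse of $A_{11}$ (i.e. $A_{11}Z_{11}^* = I$), then $$A - AZ^*A = \begin{bmatrix} 0 & 0 \\ A_{21} - A_{21}Z_{11}^*A_{11}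 & A_{22} - A_{21}Z_{11}^*A_{12} \end{bmatrix},$$ where the non-zero block is of size $M_K\times(N+K)$.
   Context: The AZ algorithm takes as input matrices $A, Z\in\mathbb{C}^{M\times N'}$ and a vector $\mathbf{b}\in\mathbb{C}^M$ and computes $\mathbf{x}$ with $A\mathbf{x}\approx\mathbf{b}$ in the least squares sense as follows: (step 1, the "first AZ equation") solve $(A-AZ^*A)\mathbf{x}_1 = (I-AZ^* )\mathbf{b}$; (step 2) set $\mathbf{x}_2 = Z^*(\mathbf{b}-A\mathbf{x}_1)$; (step 3) set $\mathbf{x}=\mathbf{x}_1+\mathbf{x}_2$. Here $M = M_N+M_K$ and $N' = N+K$. In the application, $A$ arises by sampling an enriched basis $\{\varphi_n\}_{n=1}^N\cup\{\psi_k\}_{k=1}^K$ with $M_N+M_K$ linear sampling functionals. The "non-zero block" means the block that is not identically zero by structure (its entries may happen to vanish). *)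

theory Defs
  imports "Jordan_Normal_Form.Schur_Decomposition"
begin

(* Coefficient matrix of the first AZ equation (A - A Z' A) x1 = (I - A Z') b,
   where Z' is the conjugate transpose of Z. *)
definition az_system_matrix :: "complex mat \<Rightarrow> complex mat \<Rightarrow> complex mat" where
  "az_system_matrix A Z = A - A * mat_adjoint Z * A"

(* Horizontal counterpart of the library's append_rows; meant for matrices with
   equally many rows. *)
definition append_cols :: "'a :: zero mat \<Rightarrow> 'a mat \<Rightarrow> 'a mat" (infixr \<open>@\<^sub>c\<close> 65) where
  "A @\<^sub>c B = four_block_mat A B (0\<^sub>m 0 (dim_col A)) (0\<^sub>m 0 (dim_col B))"

end

theory Submission
  imports Defs
begin

text \<open>Write \<open>W\<close> for the adjoint of \<open>Z11\<close>. Since \<open>W\<close> is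
  the only non-zero block of the adjoint of \<open>Z\<close>, the product
  \<open>A * mat_adjoint Z * A\<close> is the first block column of \<open>A\<close>, times
  \<open>W\<close>, times the first block row of \<open>A\<close>. Hence block (i,j) of the system
  matrix is \<open>Aij - Ai1 * W * A1j\<close>, with no assumption on \<open>W\<close> beyond its
  size (\<open>az_system_matrix_four_block\<close>). If \<open>W * A11\<close> is the identity, the
  blocks with j = 1 cancel, so the first block column vanishes
  (\<open>minus_mult_left_inverse_mat\<close>). If \<open>A11 * W\<close> is the identity, those
  with i = 1 cancel, so the first block row vanishes (\<open>minus_mult_right_inverse_mat\<close>).
  A two-sided inverse gives both and leaves only the Schur complement of \<open>A11\<close>.\<close>

lemma minus_four_block_mat:
  fixes A1 B1 C1 D1 A2 B2 C2 D2 :: "'a :: group_add mat"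
  assumes "A1 \<in> carrier_mat nr1 nc1" "B1 \<in> carrier_mat nr1 nc2"
    "C1 \<in> carrier_mat nr2 nc1" "D1 \<in> carrier_mat nr2 nc2"
    "A2 \<in> carrier_mat nr1 nc1" "B2 \<in> carrier_mat nr1 nc2"
    "C2 \<in> carrier_mat nr2 nc1" "D2 \<in> carrier_mat nr2 nc2"
  shows "four_block_mat A1 B1 C1 D1 - four_block_mat A2 B2 C2 D2
    = four_block_mat (A1 - A2) (B1 - B2) (C1 - C2) (D1 - D2)"
  by (rule eq_matI) (use assms in auto)

lemma mat_adjoint_carrier_mat:
  assumes "A \<in> carrier_mat m n"
  shows "mat_adjoint A \<in> carrier_mat n m"
  using assms by (auto simp: mat_adjoint_def mat_of_rows_def)

lemma append_cols_carrier_mat: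
  assumes "A \<in> carrier_mat m n" "B \<in> carrier_mat m k"
  shows "A @\<^sub>c B \<in> carrier_mat m (n + k)"
  using assms by (auto simp: append_cols_def)

text \<open>Used with \<open>P\<close> equal to \<open>A11\<close> and to \<open>A21\<close>, the
  two blocks of the first block column.\<close>

lemma minus_mult_left_inverse_mat:
  fixes B W P :: "'a :: ring_1 mat"
  assumes "B \<in> carrier_mat m n" "W \<in> carrier_mat n m" "P \<in> carrier_mat k n"
    and "inverts_mat W B"
  shows "P - P * W * B = 0\<^sub>m k n"
proof -
  \<comment> \<open>Products nest to the left, so the factor \<open>W * B\<close> that equals the
    identity appears only after reassociation.\<close>
  have "P * W * B = P * (W * B)"
    using assms by (intro assoc_mult_mat)
  also have "\<dots> = P"
    using assms by (simp add: inverts_mat_def)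
  finally show ?thesis
    using assms by simp
qed

text \<open>Mirror image for the first block row, with \<open>Q\<close> equal to \<open>A11\<close>
  and to \<open>A12\<close>. Here \<open>B * W\<close> is already a subterm, so it rewrites to the
  identity directly.\<close>

lemma minus_mult_right_inverse_mat:
  fixes B W Q :: "'a :: ring_1 mat"
  assumes "B \<in> carrier_mat m n" "W \<in> carrier_mat n m" "Q \<in> carrier_mat m k"
    and "inverts_mat B W"
  shows "Q - B * W * Q = 0\<^sub>m m k"
  using assms by (simp add: inverts_mat_def)

lemma az_system_matrix_four_block:
  fixes A11 A12 A21 A22 W Z :: "complex mat"
  assumes A: "A11 \<in> carrier_mat m n" "A12 \<in> carrier_mat m k"
      "A21 \<in> carrier_mat l n" "A22 \<in> carrier_mat l k"
    and W: "W \<in> carrier_mat n m"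
    and Z: "mat_adjoint Z = four_block_mat W (0\<^sub>m n l) (0\<^sub>m k m) (0\<^sub>m k l)"
  shows "az_system_matrix (four_block_mat A11 A12 A21 A22) Z =
    four_block_mat (A11 - A11 * W * A11) (A12 - A11 * W * A12)
      (A21 - A21 * W * A11) (A22 - A21 * W * A12)"
proof -
  let ?A = "four_block_mat A11 A12 A21 A22"
  \<comment> \<open>The inner dimension splits as \<open>n + k\<close> here and as
    \<open>m + l\<close> in the next product. The zero blocks of the adjoint of \<open>Z\<close>
    discard \<open>A12\<close> and \<open>A22\<close> here, and the resulting zero columns then
    discard the lower block row of the right factor.\<close>
  have AZ: "?A * mat_adjoint Z =
      four_block_mat (A11 * W) (0\<^sub>m m l) (A21 * W) (0\<^sub>m l l)"
    unfolding Z using A W by (subst mult_four_block_mat[of _ m n _ k _ l _ _ m _ l]) auto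
  have "?A * mat_adjoint Z * ?A =
      four_block_mat (A11 * W * A11) (A11 * W * A12) (A21 * W * A11) (A21 * W * A12)"
    unfolding AZ using A W by (subst mult_four_block_mat[of _ m m _ l _ l _ _ n _ k]) auto
  then show ?thesis
    unfolding az_system_matrix_def
    using A W by (auto intro!: minus_four_block_mat)
qed

theorem theorem2:
  fixes A A11 A12 A21 A22 Z Z11 :: "complex mat"
    and N K M\<^sub>N M\<^sub>K :: nat
  assumes A11: "A11 \<in> carrier_mat M\<^sub>N N"
    and A12: "A12 \<in> carrier_mat M\<^sub>N K"
    and A21: "A21 \<in> carrier_mat M\<^sub>K N"
    and A22: "A22 \<in> carrier_mat M\<^sub>K K"
    and A: "A = four_block_mat A11 A12 A21 A22"
    and Z11: "Z11 \<in> carrier_mat M\<^sub>N N"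
    and Z: "Z \<in> carrier_mat (M\<^sub>N + M\<^sub>K) (N + K)"
    and Z_adj: "mat_adjoint Z =
      four_block_mat (mat_adjoint Z11) (0\<^sub>m N M\<^sub>K) (0\<^sub>m K M\<^sub>N) (0\<^sub>m K M\<^sub>K)"
  shows
    "(inverts_mat A11 (mat_adjoint Z11) \<and> inverts_mat (mat_adjoint Z11) A11 \<longrightarrow>
        az_system_matrix A Z =
          four_block_mat
            (0\<^sub>m M\<^sub>N N) (0\<^sub>m M\<^sub>N K)
            (0\<^sub>m M\<^sub>K N) (A22 - A21 * mat_adjoint Z11 * A12)
        \<and> A22 - A21 * mat_adjoint Z11 * A12 \<in> carrier_mat M\<^sub>K K)
     \<and> (inverts_mat (mat_adjoint Z11) A11 \<longrightarrow>
        az_system_matrix A Z =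
          four_block_mat
            (0\<^sub>m M\<^sub>N N) (A12 - A11 * mat_adjoint Z11 * A12)
            (0\<^sub>m M\<^sub>K N) (A22 - A21 * mat_adjoint Z11 * A12)
        \<and> (A12 - A11 * mat_adjoint Z11 * A12) @\<^sub>r (A22 - A21 * mat_adjoint Z11 * A12)
            \<in> carrier_mat (M\<^sub>N + M\<^sub>K) K)
     \<and> (inverts_mat A11 (mat_adjoint Z11) \<longrightarrow>
        az_system_matrix A Z =
          four_block_mat
            (0\<^sub>m M\<^sub>N N) (0\<^sub>m M\<^sub>N K)
            (A21 - A21 * mat_adjoint Z11 * A11) (A22 - A21 * mat_adjoint Z11 * A12)
        \<and> (A21 - A21 * mat_adjoint Z11 * A11) @\<^sub>c (A22 - A21 * mat_adjoint Z11 * A12)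
            \<in> carrier_mat M\<^sub>K (N + K))"
proof -
  let ?W = "mat_adjoint Z11"
  have W: "?W \<in> carrier_mat N M\<^sub>N"
    using Z11 by (rule mat_adjoint_carrier_mat)
  have system: "az_system_matrix A Z =
      four_block_mat (A11 - A11 * ?W * A11) (A12 - A11 * ?W * A12)
        (A21 - A21 * ?W * A11) (A22 - A21 * ?W * A12)"
    unfolding A using A11 A12 A21 A22 W Z_adj by (rule az_system_matrix_four_block)
  have left: "A11 - A11 * ?W * A11 = 0\<^sub>m M\<^sub>N N" "A21 - A21 * ?W * A11 = 0\<^sub>m M\<^sub>K N"
    if "inverts_mat ?W A11"
    using minus_mult_left_inverse_mat[OF A11 W A11 that]
      minus_mult_left_inverse_mat[OF A11 W A21 that] .
  have right: "A11 - A11 * ?W * A11 = 0\<^sub>m M\<^sub>N N" "A12 - A11 * ?W * A12 = 0\<^sub>m M\<^sub>N K"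
    if "inverts_mat A11 ?W"
    using minus_mult_right_inverse_mat[OF A11 W A11 that]
      minus_mult_right_inverse_mat[OF A11 W A12 that] .
  have blocks: "A12 - A11 * ?W * A12 \<in> carrier_mat M\<^sub>N K"
      "A21 - A21 * ?W * A11 \<in> carrier_mat M\<^sub>K N"
      "A22 - A21 * ?W * A12 \<in> carrier_mat M\<^sub>K K"
    using A11 A12 A21 A22 W by auto
  \<comment> \<open>With a two-sided inverse, \<open>left\<close> clears the first block column and
    \<open>right\<close> the upper right block. The facts in \<open>blocks\<close> supply the
    sizes.\<close>
  show ?thesis
    using left right blocks
    by (auto simp only: system intro: carrier_append_rows append_cols_carrier_mat)
qed

end
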